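(* Every compact, monotonically normal, $nwd$-separable space has a $\sigma$-disjoint $\pi$-base.
   Context: A space is $nwd$-separable if it has a dense subset which is a countable union of nowhere dense sets. A $\pi$-base is $\sigma$-disjoint if it is a countable union of families of pairwise disjoint open sets. *)

theory Defs
  imports "HOL-Analysis.Analysis"
begin

definition monotonically_normal :: "'a topology \<Rightarrow> bool" where
  "monotonically_normal X \<longleftrightarrow> t1_space X \<and>
     (\<exists>H :: 'a \<Rightarrow> 'a set \<Rightarrow> 'a set.
        (\<forall>p U. openin X U \<and> p \<in> U \<longrightarrow> openin X (H p U) \<and> p \<in> H p U \<and> H p U \<subseteq> U) \<and>
        (\<forall>p q U V. openin X U \<and> p \<in> U \<and> openin X V \<and> q \<in> V \<and> H p U \<inter> H q V \<noteq> {}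
            \<longrightarrow> p \<in> V \<or> q \<in> U))"

definition nowhere_dense_in :: "'a topology \<Rightarrow> 'a set \<Rightarrow> bool" where
  "nowhere_dense_in X A \<longleftrightarrow> A \<subseteq> topspace X \<and> X interior_of (X closure_of A) = {}"

definition dense_in_top :: "'a topology \<Rightarrow> 'a set \<Rightarrow> bool" where
  "dense_in_top X D \<longleftrightarrow> D \<subseteq> topspace X \<and> X closure_of D = topspace X"

definition nwd_separable :: "'a topology \<Rightarrow> bool" where
  "nwd_separable X \<longleftrightarrow> (\<exists>\<F>. countable \<F> \<and> (\<forall>A\<in>\<F>. nowhere_dense_in X A) \<and> dense_in_top X (\<Union>\<F>))"

definition pi_base :: "'a topology \<Rightarrow> 'a set set \<Rightarrow> bool" where
  "pi_base X \<B> \<longleftrightarrow> (\<forall>B\<in>\<B>. openin X B \<and> B \<noteq> {}) \<and>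
     (\<forall>U. openin X U \<and> U \<noteq> {} \<longrightarrow> (\<exists>B\<in>\<B>. B \<subseteq> U))"

definition sigma_disjoint :: "'a topology \<Rightarrow> 'a set set \<Rightarrow> bool" where
  "sigma_disjoint X \<B> \<longleftrightarrow> (\<forall>B\<in>\<B>. openin X B) \<and>
     (\<exists>\<C> :: nat \<Rightarrow> 'a set set. \<B> = (\<Union>n. \<C> n) \<and> (\<forall>n. pairwise disjnt (\<C> n)))"

end

(*
  Let H be a monotone normality operator and K a closed nowhere dense set. Take a maximal disjoint
  family of sets C = H x G with x in G open and G disjoint from K, and shrink each C to D = H x C.

  If U is open and meets K in v, put V = H v U, whose closure lies in U. As the closure of every
  C misses K, each neighbourhood of v meets infinitely many C. Any C meeting H v V has its
  centre x in V, because v is not in G. Now cover the compact complement of U by finitely many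
  sets H e (X - closure V). If x is in V and D = H x C meets such a set, then e is in C, which
  holds for at most one C. So all but finitely many of the D centred in V lie in U.

  Letting K range over the closures of the given nowhere dense sets, the families of all D together
  form the required pi-base.
*)
theory Submission
  imports Defs
begin

text \<open>Names the witness inside \<open>monotonically_normal\<close>, so that one fixed operator
  can be passed from lemma to lemma.\<close>

definition mn_operator :: "'a topology \<Rightarrow> ('a \<Rightarrow> 'a set \<Rightarrow> 'a set) \<Rightarrow> bool" where
  "mn_operator X H \<longleftrightarrow>
     (\<forall>p U. openin X U \<and> p \<in> U \<longrightarrow> openin X (H p U) \<and> p \<in> H p U \<and> H p U \<subseteq> U) \<and>
     (\<forall>p q U V. openin X U \<and> p \<in> U \<and> openin X V \<and> q \<in> V \<and> H p U \<inter> H q V \<noteq> {}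
        \<longrightarrow> p \<in> V \<or> q \<in> U)"

lemma mn_operatorD:
  assumes "mn_operator X H" "openin X U" "p \<in> U"
  shows "openin X (H p U)" "p \<in> H p U" "H p U \<subseteq> U"
  using assms(1)[unfolded mn_operator_def, THEN conjunct1, rule_format, of U p] assms(2,3) by auto

lemma mn_operator_meetD:
  assumes "mn_operator X H" "openin X U" "p \<in> U" "openin X V" "q \<in> V" "H p U \<inter> H q V \<noteq> {}"
  shows "p \<in> V \<or> q \<in> U"
  using assms(1)[unfolded mn_operator_def, THEN conjunct2, rule_format, of U p V q] assms(2-)
  by simp

text \<open>A point \<open>q\<close> outside \<open>U\<close> has the neighbourhood
  \<open>H q (topspace X - {p})\<close>, open because points are closed. It misses
  \<open>H p U\<close>, as otherwise \<open>p\<close> would differ from itself or \<open>q\<close>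
  would lie in \<open>U\<close>.\<close>

lemma mn_operator_closure_subset:
  assumes "t1_space X" and H: "mn_operator X H" and U: "openin X U" "p \<in> U"
  shows "X closure_of (H p U) \<subseteq> U"
proof
  fix q assume q: "q \<in> X closure_of (H p U)"
  show "q \<in> U"
  proof (rule ccontr)
    assume "q \<notin> U"
    have top: "p \<in> topspace X" "q \<in> topspace X"
      using U openin_subset q by (auto simp: in_closure_of)
    let ?V = "topspace X - {p}"
    have V: "openin X ?V" "q \<in> ?V"
      using closedin_t1_singleton[OF assms(1) top(1)] top(2) U(2) \<open>q \<notin> U\<close> by blast+
    have "\<exists>y. y \<in> H p U \<and> y \<in> H q ?V"
      using q mn_operatorD(1,2)[OF H V] by (simp add: in_closure_of)
    then have "H p U \<inter> H q ?V \<noteq> {}" by blast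
    then show False
      using mn_operator_meetD[OF H U V] \<open>q \<notin> U\<close> by simp
  qed
qed

text \<open>Zorn's lemma: any two points in the union of a chain already lie in one member, so the
  union inherits \<open>pairwise R\<close>. The relation is arbitrary so that indices, not just
  sets, can be chosen.\<close>

lemma maximal_pairwise_subset:
  obtains M where "M \<subseteq> A" "pairwise R M"
    "\<And>N. N \<subseteq> A \<Longrightarrow> pairwise R N \<Longrightarrow> M \<subseteq> N \<Longrightarrow> N = M"
proof -
  let ?F = "{M. M \<subseteq> A \<and> pairwise R M}"
  have "\<exists>M\<in>?F. \<forall>N\<in>?F. M \<subseteq> N \<longrightarrow> N = M"
  proof (rule subset_Zorn')
    fix \<C> assume c: "subset.chain ?F \<C>"
    then have chain: "\<And>S T. S \<in> \<C> \<Longrightarrow> T \<in> \<C> \<Longrightarrow> S \<subseteq> T \<or> T \<subseteq> S"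
      and mem: "\<And>S. S \<in> \<C> \<Longrightarrow> S \<subseteq> A \<and> pairwise R S"
      by (auto simp: subset_chain_def)
    have "pairwise R (\<Union>\<C>)"
      unfolding pairwise_def
    proof (intro ballI impI)
      fix x y assume "x \<in> \<Union>\<C>" "y \<in> \<Union>\<C>" "x \<noteq> y"
      then obtain S T where "S \<in> \<C>" "T \<in> \<C>" "x \<in> S" "y \<in> T" by blast
      with chain[of S T] obtain Q where "Q \<in> \<C>" "x \<in> Q" "y \<in> Q" by blast
      with mem \<open>x \<noteq> y\<close> show "R x y" by (meson pairwiseD)
    qed
    with mem show "\<Union>\<C> \<in> ?F" by blast
  qed
  then obtain M where "M \<in> ?F" "\<forall>N\<in>?F. M \<subseteq> N \<longrightarrow> N = M" by (elim bexE)
  then show thesis by (intro that[of M]) auto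
qed

lemma disjoint_family_at_nowhere_dense:
  assumes X: "compact_space X" "t1_space X" and H: "mn_operator X H"
    and K: "closedin X K" "X interior_of K = {}"
  obtains \<D> where "pairwise disjnt \<D>" "\<And>D. D \<in> \<D> \<Longrightarrow> openin X D \<and> D \<noteq> {}"
    "\<And>U. openin X U \<Longrightarrow> U \<inter> K \<noteq> {} \<Longrightarrow> \<exists>D\<in>\<D>. D \<subseteq> U"
proof -
  \<comment> \<open>Maximality is taken over pairs (centre, open set) rather than over sets, since
    the centre of \<open>C z\<close> must remain available to form \<open>D z\<close>.\<close>
  define P where "P = {(x, G). openin X G \<and> x \<in> G \<and> G \<inter> K = {}}"
  define C where "C = (\<lambda>(x, G). H x G)"
  define D where "D = (\<lambda>z. H (fst z) (C z))"
  obtain M where M: "M \<subseteq> P" "pairwise (\<lambda>y z. disjnt (C y) (C z)) M"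
    and max: "\<And>N. N \<subseteq> P \<Longrightarrow> pairwise (\<lambda>y z. disjnt (C y) (C z)) N \<Longrightarrow> M \<subseteq> N \<Longrightarrow> N = M"
    using maximal_pairwise_subset by blast
  have Pin: "openin X (snd z)" "fst z \<in> snd z" "snd z \<inter> K = {}" if "z \<in> P" for z
    using that by (auto simp: P_def)
  have C_eq: "C z = H (fst z) (snd z)" for z
    by (simp add: C_def case_prod_beta)
  have Cz: "openin X (C z)" "fst z \<in> C z" "C z \<subseteq> snd z" "X closure_of (C z) \<subseteq> snd z"
    if "z \<in> P" for z
    using mn_operatorD[OF H Pin(1,2)[OF that]]
      mn_operator_closure_subset[OF X(2) H Pin(1,2)[OF that]]
    by (auto simp: C_eq)
  have Dz: "openin X (D z)" "fst z \<in> D z" "D z \<subseteq> C z" if "z \<in> P" for z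
    using mn_operatorD[OF H Cz(1,2)[OF that]] by (auto simp: D_def)
  have same: "y = z" if "y \<in> M" "z \<in> M" "e \<in> C y" "e \<in> C z" for y z e
    using M(2) that unfolding pairwise_def disjnt_def by blast
  have meets: "\<exists>z\<in>M. C z \<inter> G \<noteq> {}" if G: "openin X G" "G \<noteq> {}" "G \<inter> K = {}" for G
  proof (rule ccontr)
    assume con: "\<not> ?thesis"
    obtain x where x: "x \<in> G" using G by blast
    \<comment> \<open>\<open>C ?z\<close> lies in \<open>G\<close>, which no chosen
      \<open>C z\<close> meets, so \<open>?z\<close> can be added to \<open>M\<close>. By maximality
      it is already there, yet \<open>C ?z\<close> meets \<open>G\<close> in
      \<open>x\<close>.\<close>
    let ?z = "(x, G)"
    have zP: "?z \<in> P" using G x by (simp add: P_def)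
    have sub: "C ?z \<subseteq> G" "x \<in> C ?z" using Cz[OF zP] by auto
    have "insert ?z M = M"
    proof (rule max)
      show "insert ?z M \<subseteq> P" using M zP by blast
      show "pairwise (\<lambda>y z. disjnt (C y) (C z)) (insert ?z M)"
        using M(2) con sub unfolding pairwise_insert disjnt_def by blast
    qed blast
    then show False using con sub x by blast
  qed
  have infinitely_many: "infinite {z \<in> M. C z \<inter> G \<noteq> {}}"
    if G: "openin X G" "G \<inter> K \<noteq> {}" for G
  proof
    define N where "N = {z \<in> M. C z \<inter> G \<noteq> {}}"
    \<comment> \<open>A finite union of closures is closed, and it misses \<open>K\<close>. Hence
      \<open>G - L\<close> is a nonempty open set, which \<open>K\<close> cannot contain, and
      \<open>G - L - K\<close> must meet some \<open>C z\<close>. This \<open>z\<close> is in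
      \<open>N\<close>, so \<open>C z\<close> lies in \<open>L\<close>, a contradiction.\<close>
    define L where "L = (\<Union>z\<in>N. X closure_of (C z))"
    assume "finite {z \<in> M. C z \<inter> G \<noteq> {}}"
    then have fin: "finite N" by (simp add: N_def)
    have NM: "N \<subseteq> M" by (auto simp: N_def)
    have "closedin X L" unfolding L_def using fin by (intro closedin_Union) auto
    then have G': "openin X (G - L)" using G by blast
    have "L \<inter> K = {}" unfolding L_def using Cz(4) Pin(3) M(1) NM by fast
    then have "G - L \<noteq> {}" using G by blast
    then have "\<not> G - L \<subseteq> K" using K(2) G' interior_of_maximal by blast
    then have "G - L - K \<noteq> {}" "openin X (G - L - K)" using G' K by auto
    then obtain z where z: "z \<in> M" "C z \<inter> (G - L - K) \<noteq> {}"
      using meets[of "G - L - K"] by (metis Diff_disjoint Int_commute)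
    then have "z \<in> N" by (auto simp: N_def)
    moreover have "C z \<subseteq> X closure_of (C z)"
      using z(1) M(1) Cz(1)[of z] by (simp add: closure_of_subset openin_subset subsetD)
    ultimately have "C z \<subseteq> L" unfolding L_def by blast
    then show False using z(2) by blast
  qed
  have "\<exists>D'\<in>D ` M. D' \<subseteq> U" if U: "openin X U" "U \<inter> K \<noteq> {}" for U
  proof -
    obtain v where v: "v \<in> U" "v \<in> K" using U by blast
    define V where "V = H v U"
    have V: "openin X V" "v \<in> V" "X closure_of V \<subseteq> U" "V \<subseteq> X closure_of V"
      using mn_operatorD[OF H U(1) v(1)] mn_operator_closure_subset[OF X(2) H U(1) v(1)]
      by (auto simp: V_def closure_of_subset openin_subset)
    \<comment> \<open>\<open>?W\<close> contains every point outside \<open>U\<close>, because the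
      closure of \<open>V\<close> lies in \<open>U\<close>, and it is disjoint from
      \<open>V\<close>.\<close>
    let ?W = "topspace X - X closure_of V"
    have W: "openin X ?W" by auto
    have sW: "e \<in> ?W" if "e \<in> topspace X - U" for e using that V by blast
    have "compactin X (topspace X - U)"
      using U X(1) by (simp add: closedin_compact_space closedin_diff)
    moreover have "topspace X - U \<subseteq> (\<Union>e\<in>topspace X - U. H e ?W)"
      using mn_operatorD(2)[OF H W] sW by blast
    moreover have "\<forall>T\<in>(\<lambda>e. H e ?W) ` (topspace X - U). openin X T"
      using mn_operatorD(1)[OF H W] sW by blast
    ultimately obtain \<T> where \<T>: "finite \<T>" "\<T> \<subseteq> (\<lambda>e. H e ?W) ` (topspace X - U)"
      "topspace X - U \<subseteq> \<Union>\<T>"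
      unfolding compactin_def by meson
    then obtain E where E: "finite E" "E \<subseteq> topspace X - U" "\<T> = (\<lambda>e. H e ?W) ` E"
      by (meson finite_subset_image)
    \<comment> \<open>The exceptional indices: by \<open>same\<close>, each of the finitely many
      \<open>e\<close> accounts for at most one.\<close>
    let ?B = "\<Union>e\<in>E. {z \<in> M. e \<in> C z}"
    have "finite {z \<in> M. e \<in> C z}" for e
    proof (cases "{z \<in> M. e \<in> C z} = {}")
      case False
      then obtain y where "{z \<in> M. e \<in> C z} \<subseteq> {y}" using same by blast
      then show ?thesis using finite_subset by blast
    next
      case True
      then show ?thesis by (metis finite.emptyI)
    qed
    then have fin: "finite ?B" using E(1) by blast
    \<comment> \<open>Meeting \<open>V\<close> itself would say nothing about centres; applying
      \<open>H\<close> once more forces the centre of a \<open>C z\<close> that meets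
      \<open>H v V\<close> into \<open>V\<close>.\<close>
    have HV: "openin X (H v V)" "H v V \<inter> K \<noteq> {}" using mn_operatorD[OF H V(1,2)] v(2) by auto
    have "{z \<in> M. C z \<inter> H v V \<noteq> {}} - ?B \<noteq> {}"
      using infinite_imp_nonempty[OF Diff_infinite_finite[OF fin infinitely_many[OF HV]]] .
    then obtain z where z: "z \<in> M" "C z \<inter> H v V \<noteq> {}" "z \<notin> ?B" by blast
    have zP: "z \<in> P" using z M by blast
    have "fst z \<in> V"
      using mn_operator_meetD[OF H Pin(1,2)[OF zP] V(1,2)] z(2) Pin(3)[OF zP] v(2)
      by (auto simp: C_eq)
    have "D z \<subseteq> U"
    proof (rule ccontr)
      assume "\<not> D z \<subseteq> U"
      then obtain e where e: "e \<in> E" "D z \<inter> H e ?W \<noteq> {}"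
        using \<T>(3) E(3) openin_subset[OF Dz(1)[OF zP]] by blast
      \<comment> \<open>Here the second shrinking pays off: \<open>D z\<close> is \<open>H\<close>
        applied to \<open>C z\<close>, so the alternative to a centre in \<open>?W\<close> is
        \<open>e\<close> in \<open>C z\<close>, which \<open>z \<notin> ?B\<close> excludes.\<close>
      then have "fst z \<in> ?W \<or> e \<in> C z"
        using mn_operator_meetD[OF H Cz(1,2)[OF zP] W sW] E(2) by (auto simp: D_def)
      then show False using \<open>fst z \<in> V\<close> V(4) z e(1) by blast
    qed
    then show ?thesis using z(1) by blast
  qed
  moreover have "pairwise disjnt (D ` M)"
  proof (rule pairwise_imageI)
    fix y z assume yz: "y \<in> M" "z \<in> M" "y \<noteq> z"
    then have "D y \<subseteq> C y" "D z \<subseteq> C z" using Dz(3) M(1) by blast+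
    then show "disjnt (D y) (D z)" using same[OF yz(1,2)] yz(3) unfolding disjnt_def by blast
  qed
  moreover have "openin X D' \<and> D' \<noteq> {}" if "D' \<in> D ` M" for D'
    using that Dz(1,2) M(1) by blast
  ultimately show thesis using that by blast
qed

theorem theorem6p8:
  fixes X :: "'a topology"
  assumes "compact_space X" and "monotonically_normal X" and "nwd_separable X"
  shows "\<exists>\<B>. pi_base X \<B> \<and> sigma_disjoint X \<B>"
proof -
  obtain H where t1: "t1_space X" and H: "mn_operator X H"
    using assms(2) unfolding monotonically_normal_def mn_operator_def[symmetric] by blast
  obtain \<F> where \<F>: "countable \<F>" "\<And>A. A \<in> \<F> \<Longrightarrow> nowhere_dense_in X A"
    and "dense_in_top X (\<Union>\<F>)"
    using assms(3) unfolding nwd_separable_def by metis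
  then have dense: "X closure_of (\<Union>\<F>) = topspace X"
    by (simp add: dense_in_top_def)
  \<comment> \<open>Inserting the empty set keeps the enumerated family nonempty, so that the range
    of \<open>from_nat_into\<close> is exactly this family even when \<open>\<F>\<close> is
    empty.\<close>
  define A where "A = from_nat_into (insert {} \<F>)"
  have ran: "range A = insert {} \<F>"
    unfolding A_def using \<F>(1) by (intro range_from_nat_into) auto
  have "nowhere_dense_in X {}" by (simp add: nowhere_dense_in_def)
  then have "nowhere_dense_in X (A n)" for n
    using ran \<F>(2) by (metis insertE rangeI)
  then have A: "A n \<subseteq> X closure_of (A n)" "X interior_of (X closure_of (A n)) = {}" for n
    by (auto simp: nowhere_dense_in_def closure_of_subset)
  have "\<exists>\<D>. pairwise disjnt \<D> \<and> (\<forall>D\<in>\<D>. openin X D \<and> D \<noteq> {}) \<and>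
      (\<forall>U. openin X U \<longrightarrow> U \<inter> X closure_of (A n) \<noteq> {} \<longrightarrow> (\<exists>D\<in>\<D>. D \<subseteq> U))" for n
    using disjoint_family_at_nowhere_dense[OF assms(1) t1 H closedin_closure_of A(2)[of n]]
    by metis
  then obtain \<D> where \<D>: "\<And>n. pairwise disjnt (\<D> n)"
    "\<And>n D. D \<in> \<D> n \<Longrightarrow> openin X D \<and> D \<noteq> {}"
    "\<And>n U. openin X U \<Longrightarrow> U \<inter> X closure_of (A n) \<noteq> {} \<Longrightarrow> \<exists>D\<in>\<D> n. D \<subseteq> U"
    by metis
  have "\<exists>D\<in>\<Union>n. \<D> n. D \<subseteq> U" if U: "openin X U" "U \<noteq> {}" for U
  proof -
    \<comment> \<open>By density \<open>U\<close> meets some \<open>A n\<close>, hence its closure,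
      and the \<open>n\<close>-th family supplies a member inside \<open>U\<close>.\<close>
    have "U \<inter> \<Union>\<F> \<noteq> {}"
      using U dense openin_subset[OF U(1)] openin_Int_closure_of_eq_empty[OF U(1)] by blast
    then obtain n where "U \<inter> A n \<noteq> {}" using ran by blast
    then show ?thesis using \<D>(3)[OF U(1), of n] A(1)[of n] by blast
  qed
  then have "pi_base X (\<Union>n. \<D> n)"
    using \<D>(2) unfolding pi_base_def by blast
  moreover have "sigma_disjoint X (\<Union>n. \<D> n)"
    using \<D>(1,2) unfolding sigma_disjoint_def by blast
  ultimately show ?thesis by blast
qed

end
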